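(* For every integer $n \ge 6$, $\mathrm{eqdim}(J_{n,2}) = 3$.
   Context: For positive integers $n > k$, the Johnson graph $J_{n,k}$ has as vertices all $k$-element subsets of $\{1,\dots,n\}$, two such subsets $A,B$ being adjacent iff $|A \cap B| = k-1$. In a connected graph $G$, $d(u,v)$ is the shortest-path distance. A subset $S \subseteq V(G)$ is a distance-equalizer set of $G$ if for every two distinct vertices $u,v \in V(G)\setminus S$ there exists $x \in S$ with $d(u,x) = d(v,x)$. The equidistant dimension $\mathrm{eqdim}(G)$ is the minimum cardinality of a distance-equalizer set of $G$. *)

theory Defs
  imports "Graph_Theory.Graph_Theory"
begin

text \<open>Undirected simple graphs are represented as finite symmetric loop-free digraphs without
  parallel arcs. The graph distance is the shortest-walk cost with respect to unit arc weights;
  it is infinite for vertices that are not connected.\<close>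

definition graph_dist :: "('a, 'b) pre_digraph \<Rightarrow> 'a \<Rightarrow> 'a \<Rightarrow> ereal" where
  "graph_dist G u v = wf_digraph.\<mu> G (\<lambda>_. 1) u v"

definition distance_equalizer_set :: "('a, 'b) pre_digraph \<Rightarrow> 'a set \<Rightarrow> bool" where
  "distance_equalizer_set G S \<longleftrightarrow>
     S \<subseteq> verts G \<and>
     (\<forall>u \<in> verts G - S. \<forall>v \<in> verts G - S.
        u \<noteq> v \<longrightarrow> (\<exists>x \<in> S. graph_dist G u x = graph_dist G v x))"

definition eqdim :: "('a, 'b) pre_digraph \<Rightarrow> nat" where
  "eqdim G = (LEAST m. \<exists>S. finite S \<and> distance_equalizer_set G S \<and> card S = m)"

text \<open>Meaningful for \<open>0 < k < n\<close>.\<close>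

definition johnson_graph :: "nat \<Rightarrow> nat \<Rightarrow> nat set pair_pre_digraph" where
  "johnson_graph n k =
     \<lparr> pverts = {A. A \<subseteq> {1..n} \<and> card A = k},
       parcs = {(A, B). A \<subseteq> {1..n} \<and> card A = k \<and> B \<subseteq> {1..n} \<and> card B = k \<and>
                        card (A \<inter> B) = k - 1} \<rparr>"

lemma pair_graph_johnson_graph:
  assumes "0 < k"
  shows "pair_graph (johnson_graph n k)"
proof
  show fin: "finite (pverts (johnson_graph n k))"
    by (rule finite_subset[of _ "Pow {1..n}"]) (auto simp: johnson_graph_def)
  show "finite (parcs (johnson_graph n k))"
    by (rule finite_subset[OF _ finite_cartesian_product[OF fin fin]])
      (clarsimp simp: johnson_graph_def)
  show "symmetric (with_proj (johnson_graph n k))"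
    by (simp add: symmetric_def johnson_graph_def sym_def Int_commute)
next
  fix e assume "e \<in> parcs (johnson_graph n k)"
  then obtain A B where e: "e = (A, B)" "A \<in> pverts (johnson_graph n k)"
      "B \<in> pverts (johnson_graph n k)" "card A = k" "card (A \<inter> B) = k - 1"
    by (cases e) (simp add: johnson_graph_def)
  then show "fst e \<in> pverts (johnson_graph n k)" "snd e \<in> pverts (johnson_graph n k)"
    by simp_all
  have "A \<noteq> B"
  proof
    assume "A = B"
    with e have "k = k - 1" by simp
    with assms show False by linarith
  qed
  with e show "fst e \<noteq> snd e" by simp
qed

lemma strongly_connected_johnson_graph:
  assumes "0 < k" "k < n"
  shows "strongly_connected (with_proj (johnson_graph n k))"
proof -
  let ?J = "johnson_graph n k"
  interpret pair_graph ?J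
    using assms(1) by (rule pair_graph_johnson_graph)
  have "{1..k} \<in> pverts ?J"
    using assms by (simp add: johnson_graph_def)
  then have ne: "pverts ?J \<noteq> {}"
    by blast
  have "A \<rightarrow>\<^sup>*\<^bsub>with_proj ?J\<^esub> B" if "A \<in> pverts ?J" "B \<in> pverts ?J" for A B
    using that
  proof (induction "card (A - B)" arbitrary: A)
    case 0
    then have A: "A \<subseteq> {1..n}" "card A = k" and B: "B \<subseteq> {1..n}" "card B = k"
      by (auto simp: johnson_graph_def)
    have fin: "finite A" "finite B"
      using A B by (auto intro: finite_subset[OF _ finite_atLeastAtMost])
    then have "A \<subseteq> B" using 0 by simp
    then have "A = B" using card_subset_eq[OF fin(2)] A B by simp
    then show ?case using 0(2) by simp
  next
    case (Suc m)
    then have A: "A \<subseteq> {1..n}" "card A = k" and B: "B \<subseteq> {1..n}" "card B = k"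
      by (auto simp: johnson_graph_def)
    have fin: "finite A" "finite B"
      using A B by (auto intro: finite_subset[OF _ finite_atLeastAtMost])
    obtain a where a: "a \<in> A" "a \<notin> B"
      using Suc.hyps(2) by (cases "A - B = {}") auto
    have "\<not> B \<subseteq> A"
      using card_subset_eq[OF fin(1), of B] A B a by auto
    then obtain b where b: "b \<in> B" "b \<notin> A" by blast
    define C where "C = insert b (A - {a})"
    have C: "C \<subseteq> {1..n}" "card C = k"
      using A B a b fin assms by (auto simp: C_def)
    have "A \<inter> C = A - {a}" using b by (auto simp: C_def)
    then have "card (A \<inter> C) = k - 1" using A a fin by simp
    then have arc: "(A, C) \<in> parcs ?J" using A C by (simp add: johnson_graph_def)
    have "C - B = (A - B) - {a}" using b by (auto simp: C_def)
    then have "m = card (C - B)" using Suc.hyps(2) a fin by simp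
    moreover have "C \<in> pverts ?J" using C by (simp add: johnson_graph_def)
    ultimately have "C \<rightarrow>\<^sup>*\<^bsub>with_proj ?J\<^esub> B" using Suc.hyps(1) Suc.prems(2) by blast
    then show ?case using arc by (rule adj_reachable_trans[rotated])
  qed
  then show ?thesis using ne by (auto simp: strongly_connected_def)
qed

end

theory Submission
  imports Defs
begin

text \<open>Distinct vertices of \<open>J\<^sub>n\<^sub>,\<^sub>2\<close> are at distance 1 if they meet and at distance 2 if they are
  disjoint. A 2-set other than \<open>{1,2}\<close>, \<open>{1,3}\<close>, \<open>{2,3}\<close> meets either none of these three sets or
  exactly two of them, so any two such 2-sets agree on at least one of the three; hence three
  vertices suffice. Conversely, for vertices \<open>x\<close>, \<open>y\<close> there is a further vertex meeting both and, as
  \<open>n \<ge> 6\<close>, one disjoint from both, and neither \<open>x\<close> nor \<open>y\<close> is equidistant from these two.\<close>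

context pair_wf_digraph
begin

text \<open>With unit weights the cost is the length: the empty walk joins a vertex to itself, and a
  one-arc walk from \<open>u\<close> to \<open>v\<close> is the arc \<open>(u, v)\<close>. Since
  \<open>\<mu>\<close> is an infimum over walks, these bounds carry over to distances.\<close>

lemma awalk_cost_unit_ge:
  assumes "awalk u p v" "u \<noteq> v"
  shows "1 \<le> awalk_cost (\<lambda>_. 1) p" "(u, v) \<notin> parcs G \<Longrightarrow> 2 \<le> awalk_cost (\<lambda>_. 1) p"
proof -
  have len: "awalk_cost (\<lambda>_. 1) q = real (length q)" for q :: "('a \<times> 'a) list"
    by (induction q) auto
  show "1 \<le> awalk_cost (\<lambda>_. 1) p"
    using assms by (cases p) (auto simp: len awalk_Nil_iff)
  assume na: "(u, v) \<notin> parcs G"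
  have "p \<noteq> []" using assms by (auto simp: awalk_Nil_iff)
  moreover have "p \<noteq> [e]" for e
    using assms na by (cases e) (auto simp: awalk_simps)
  \<comment> \<open>\<open>remdups_adj.cases\<close> only supplies the case split into empty,
    singleton and longer lists.\<close>
  ultimately have "2 \<le> length p"
    by (cases p rule: remdups_adj.cases) auto
  then show "2 \<le> awalk_cost (\<lambda>_. 1) p" by (simp add: len)
qed

lemma graph_dist_arc:
  assumes "(u, v) \<in> parcs G" "u \<noteq> v"
  shows "graph_dist (with_proj G) u v = 1"
proof (rule antisym)
  have "awalk u [(u, v)] v"
    using assms in_arcsD2 by (auto simp: awalk_simps)
  from min_cost_le_walk_cost[OF this, of "\<lambda>_. 1"]
  show "graph_dist (with_proj G) u v \<le> 1"
    by (simp add: graph_dist_def one_ereal_def)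
  show "1 \<le> graph_dist (with_proj G) u v"
    unfolding graph_dist_def \<mu>_def
    using awalk_cost_unit_ge(1)[OF _ assms(2)] by (auto intro!: INF_greatest)
qed

lemma graph_dist_common_neighbour:
  assumes "(u, w) \<in> parcs G" "(w, v) \<in> parcs G" "(u, v) \<notin> parcs G" "u \<noteq> v"
  shows "graph_dist (with_proj G) u v = 2"
proof (rule antisym)
  have "awalk u [(u, w), (w, v)] v"
    using assms in_arcsD2 by (auto simp: awalk_simps)
  from min_cost_le_walk_cost[OF this, of "\<lambda>_. 1"]
  show "graph_dist (with_proj G) u v \<le> 2"
    by (simp add: graph_dist_def)
  show "2 \<le> graph_dist (with_proj G) u v"
    unfolding graph_dist_def \<mu>_def
    using awalk_cost_unit_ge(2)[OF _ assms(4,3)] by (auto intro!: INF_greatest)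
qed

end

text \<open>Disjoint pairs \<open>{a, b}\<close> and \<open>{c, d}\<close> have the common neighbour
  \<open>{a, c}\<close>; distinct pairs that meet share exactly one element and so are adjacent. At
  \<open>u = v\<close> the formula would wrongly give 1.\<close>

lemma graph_dist_johnson_2:
  assumes "u \<in> pverts (johnson_graph n 2)" "v \<in> pverts (johnson_graph n 2)" "u \<noteq> v"
  shows "graph_dist (with_proj (johnson_graph n 2)) u v = (if u \<inter> v = {} then 2 else 1)"
proof -
  interpret pair_graph "johnson_graph n 2"
    by (rule pair_graph_johnson_graph) simp
  obtain a b where u: "u = {a, b}" "a \<noteq> b" "a \<in> {1..n}" "b \<in> {1..n}"
    using assms(1) by (auto simp: johnson_graph_def card_2_iff)
  obtain c d where v: "v = {c, d}" "c \<noteq> d" "c \<in> {1..n}" "d \<in> {1..n}"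
    using assms(2) by (auto simp: johnson_graph_def card_2_iff)
  show ?thesis
  proof (cases "u \<inter> v = {}")
    case True
    then have "a \<noteq> c" "u \<inter> {a, c} = {a}" "{a, c} \<inter> v = {c}"
      using u(1) v(1) by auto
    then have "(u, {a, c}) \<in> parcs (johnson_graph n 2)" "({a, c}, v) \<in> parcs (johnson_graph n 2)"
      "(u, v) \<notin> parcs (johnson_graph n 2)"
      using u(3) v(3) assms(1,2) True by (simp_all add: johnson_graph_def)
    from graph_dist_common_neighbour[OF this assms(3)] show ?thesis
      using True by simp
  next
    case False
    then obtain e where e: "e \<in> u" "e \<in> v" by blast
    have "u \<inter> v = {e}"
    proof (rule ccontr)
      assume "u \<inter> v \<noteq> {e}"
      then have "a \<in> v \<and> b \<in> v" using e u(1) by blast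
      then have "u = v" using u(1,2) v(1) by blast
      then show False using assms(3) by simp
    qed
    then have "(u, v) \<in> parcs (johnson_graph n 2)"
      using assms(1,2) by (simp add: johnson_graph_def)
    from graph_dist_arc[OF this assms(3)] show ?thesis
      using False by simp
  qed
qed

lemma distance_equalizer_set_triangle:
  assumes "3 \<le> n"
  shows "distance_equalizer_set (with_proj (johnson_graph n 2)) {{1, 2}, {1, 3}, {2, 3}}"
    (is "distance_equalizer_set ?J ?S")
proof -
  define T :: "nat set set" where "T = ?S"
  have T: "T \<subseteq> pverts (johnson_graph n 2)"
    using assms by (auto simp: T_def johnson_graph_def)
  have "\<exists>x \<in> T. graph_dist ?J u x = graph_dist ?J v x"
    if uv: "u \<in> pverts (johnson_graph n 2) - T" "v \<in> pverts (johnson_graph n 2) - T" for u v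
  proof -
    \<comment> \<open>A 2-set containing both \<open>i\<close> and \<open>j\<close> would be
      \<open>{i, j}\<close> itself, which lies in \<open>T\<close>.\<close>
    have pairs: "i \<notin> w \<or> j \<notin> w"
      if w: "w \<in> pverts (johnson_graph n 2) - T" and ij: "{i, j} \<in> T" "i \<noteq> j" for w i j
    proof (rule ccontr)
      assume "\<not> (i \<notin> w \<or> j \<notin> w)"
      then have sub: "{i, j} \<subseteq> w" by blast
      have "finite w" "card w = 2"
        using w by (auto simp: johnson_graph_def intro: finite_subset)
      then have "{i, j} = w"
        using sub ij(2) by (intro card_subset_eq) simp_all
      then show False using w ij(1) by blast
    qed
    have profile: "(1 \<notin> w \<or> 2 \<notin> w) \<and> (1 \<notin> w \<or> 3 \<notin> w) \<and> (2 \<notin> w \<or> 3 \<notin> w)"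
      if "w \<in> pverts (johnson_graph n 2) - T" for w
      using pairs[OF that, of 1 2] pairs[OF that, of 1 3] pairs[OF that, of 2 3]
      by (simp add: T_def)
    have meets: "w \<inter> {i, j} = {} \<longleftrightarrow> i \<notin> w \<and> j \<notin> w" for w :: "nat set" and i j
      by blast
    \<comment> \<open>By \<open>meets\<close> this is propositional in the membership of 1, 2, 3 in
      \<open>u\<close> and \<open>v\<close>. By \<open>profile\<close> each of \<open>u\<close>,
      \<open>v\<close> misses all of \<open>T\<close> or exactly one member. If one of them misses
      all, they agree on a member missed by the other; if neither does, at most two members are
      missed in total and both meet a remaining one.\<close>
    have "\<exists>x \<in> T. u \<inter> x = {} \<longleftrightarrow> v \<inter> x = {}"
      using profile[OF uv(1)] profile[OF uv(2)] unfolding T_def bex_simps meets by argo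
    then obtain x where x: "x \<in> T" "u \<inter> x = {} \<longleftrightarrow> v \<inter> x = {}"
      by blast
    then have "u \<noteq> x" "v \<noteq> x" "x \<in> pverts (johnson_graph n 2)"
      using uv T by auto
    then have "graph_dist ?J u x = graph_dist ?J v x"
      using x(2) uv by (simp add: graph_dist_johnson_2)
    then show ?thesis using x(1) by blast
  qed
  then have "distance_equalizer_set ?J T"
    using T by (simp add: distance_equalizer_set_def)
  then show ?thesis by (simp only: T_def)
qed

lemma ex_johnson_2_meeting_and_disjoint:
  assumes "6 \<le> n" "x \<in> pverts (johnson_graph n 2)" "y \<in> pverts (johnson_graph n 2)"
  obtains u v where "u \<in> pverts (johnson_graph n 2)" "v \<in> pverts (johnson_graph n 2)"
    "u \<notin> {x, y}" "u \<inter> x \<noteq> {}" "u \<inter> y \<noteq> {}" "v \<inter> x = {}" "v \<inter> y = {}"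
proof -
  have xy: "x \<subseteq> {1..n}" "card x = 2" "y \<subseteq> {1..n}" "card y = 2"
    using assms(2,3) by (auto simp: johnson_graph_def)
  then have "card (x \<union> y) \<le> 4"
    using card_Un_le[of x y] by simp
  moreover have "card {1..n} - card (x \<union> y) \<le> card ({1..n} - (x \<union> y))"
    by (rule diff_card_le_card_Diff) (use xy in \<open>auto intro: finite_subset\<close>)
  \<comment> \<open>Here \<open>n \<ge> 6\<close> enters: \<open>x\<close> and \<open>y\<close>
    cover at most four points, which leaves two for \<open>v\<close>.\<close>
  ultimately have "2 \<le> card ({1..n} - (x \<union> y))"
    using assms(1) by simp
  then obtain v where v: "v \<subseteq> {1..n} - (x \<union> y)" "card v = 2"
    by (meson obtain_subset_with_card_n)
  then obtain d where d: "d \<in> {1..n}" "d \<notin> x" "d \<notin> y"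
    by (auto simp: card_2_iff)
  obtain u where u: "u \<subseteq> {1..n}" "card u = 2" "u \<notin> {x, y}" "u \<inter> x \<noteq> {}" "u \<inter> y \<noteq> {}"
  proof (cases "x \<inter> y = {}")
    case True
    \<comment> \<open>One point from each set; by disjointness \<open>{p, q}\<close> is neither
      \<open>x\<close> nor \<open>y\<close>.\<close>
    obtain p q where pq: "p \<in> x" "q \<in> y"
      using xy by (auto simp: card_2_iff)
    with True have "p \<noteq> q" "p \<notin> y" "q \<notin> x"
      by auto
    with pq have "{p, q} \<subseteq> {1..n}" "card {p, q} = 2" "{p, q} \<notin> {x, y}"
        "{p, q} \<inter> x \<noteq> {}" "{p, q} \<inter> y \<noteq> {}"
      using xy(1,3) by auto
    then show ?thesis by (rule that)
  next
    case False
    \<comment> \<open>This case includes \<open>x = y\<close>. A shared point is completed by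
      \<open>d\<close>, which lies outside both sets and so makes the pair new.\<close>
    then obtain a where "a \<in> x" "a \<in> y" by blast
    moreover from this d have "a \<noteq> d" by blast
    ultimately have "{a, d} \<subseteq> {1..n}" "card {a, d} = 2" "{a, d} \<notin> {x, y}"
        "{a, d} \<inter> x \<noteq> {}" "{a, d} \<inter> y \<noteq> {}"
      using xy(1,3) d by auto
    then show ?thesis by (rule that)
  qed
  show thesis
  proof (rule that)
    show "u \<in> pverts (johnson_graph n 2)" "v \<in> pverts (johnson_graph n 2)"
      using u(1,2) v by (auto simp: johnson_graph_def)
    show "v \<inter> x = {}" "v \<inter> y = {}"
      using v(1) by auto
  qed (use u in auto)
qed

lemma card_distance_equalizer_set_ge:
  assumes "6 \<le> n" "finite S" "distance_equalizer_set (with_proj (johnson_graph n 2)) S"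
  shows "3 \<le> card S"
proof (rule ccontr)
  let ?J = "with_proj (johnson_graph n 2)"
  assume "\<not> 3 \<le> card S"
  then have "card S = 0 \<or> card S = 1 \<or> card S = 2" by linarith
  moreover have S: "S \<subseteq> pverts (johnson_graph n 2)"
    using assms(3) by (simp add: distance_equalizer_set_def)
  \<comment> \<open>A default vertex: when \<open>S\<close> is empty there is still something to
    take for \<open>x\<close> and \<open>y\<close>. They may coincide, so a singleton
    \<open>S\<close> is covered too.\<close>
  moreover have "{1, 2} \<in> pverts (johnson_graph n 2)"
    using assms(1) by (simp add: johnson_graph_def)
  ultimately obtain x y where xy: "S \<subseteq> {x, y}" "x \<in> pverts (johnson_graph n 2)"
      "y \<in> pverts (johnson_graph n 2)"
    using assms(2) by (auto simp: card_1_singleton_iff card_2_iff)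
  obtain u v where uv: "u \<in> pverts (johnson_graph n 2)" "v \<in> pverts (johnson_graph n 2)"
      "u \<notin> {x, y}" "u \<inter> x \<noteq> {}" "u \<inter> y \<noteq> {}" "v \<inter> x = {}" "v \<inter> y = {}"
    using ex_johnson_2_meeting_and_disjoint[OF assms(1) xy(2,3)] .
  \<comment> \<open>If \<open>v\<close> were \<open>x\<close> or \<open>y\<close>, it would be
    disjoint from itself and hence empty, yet \<open>u\<close> meets both \<open>x\<close> and
    \<open>y\<close>.\<close>
  have "v \<notin> {x, y}" "u \<noteq> v"
    using uv by auto
  then obtain z where z: "z \<in> S" "graph_dist ?J u z = graph_dist ?J v z"
    using assms(3) xy(1) uv(1-3) unfolding distance_equalizer_set_def with_proj_simps
    by (meson DiffI subsetD)
  have "z = x \<or> z = y" using z(1) xy(1) by blast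
  then have "u \<noteq> z" "v \<noteq> z" "u \<inter> z \<noteq> {}" "v \<inter> z = {}" "z \<in> pverts (johnson_graph n 2)"
    using uv(3-7) xy(2,3) \<open>v \<notin> {x, y}\<close> by (elim disjE; simp)+
  then have "graph_dist ?J u z = 1" "graph_dist ?J v z = 2"
    using uv(1,2) by (simp_all add: graph_dist_johnson_2)
  with z(2) show False by (simp add: one_ereal_def)
qed

theorem theorem3:
  fixes n :: nat
  assumes "n \<ge> 6"
  shows "eqdim (with_proj (johnson_graph n 2)) = 3"
  unfolding eqdim_def
proof (rule Least_equality)
  have "card {{1, 2}, {1, 3}, {2, 3 :: nat}} = 3"
    by (simp add: doubleton_eq_iff)
  moreover have "distance_equalizer_set (with_proj (johnson_graph n 2)) {{1, 2}, {1, 3}, {2, 3}}"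
    using assms by (intro distance_equalizer_set_triangle) simp
  ultimately show "\<exists>S. finite S \<and> distance_equalizer_set (with_proj (johnson_graph n 2)) S \<and>
      card S = 3"
    by (intro exI[of _ "{{1, 2}, {1, 3}, {2, 3}}"] conjI) simp_all
next
  fix m assume "\<exists>S. finite S \<and> distance_equalizer_set (with_proj (johnson_graph n 2)) S \<and>
      card S = m"
  then show "3 \<le> m"
    using card_distance_equalizer_set_ge[OF assms] by blast
qed

end
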